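(* Let $(f,\Gamma)$ be a type 1 pair as in the context, with $f$ concave in $\Gamma$, $\frac{\partial f}{\partial\lambda_i}>0$ in $\Gamma$ for all $1\le i\le n$, and $(0,\ldots,0,1)\in\partial\Gamma_{\mathcal G}^f$. Fix a constant $\varrho>0$ with $n-\varrho_{\Gamma_{\mathcal G}^f}<\varrho<n$, and let $(\tilde f,\tilde\Gamma)$ be the associated pair $$\tilde\Gamma:=P(\Gamma),\qquad \tilde f(P(\lambda)):=f(\lambda)\ (\lambda\in\Gamma),\qquad P(\lambda):=\sum_{j=1}^n\lambda_j\,\vec{\mathbf 1}-\varrho\lambda .$$ For $t\ge1$, denote $$f^t(\lambda)=\tilde f\Big(t\sum_{i=1}^n\lambda_i\,\vec{\mathbf 1}-\varrho_{\tilde\Gamma_{\mathcal G}^{\tilde f}}\lambda\Big),\qquad \Gamma^t=\Big\{\lambda\in\mathbb R^n:\ t\sum_{i=1}^n\lambda_i\,\vec{\mathbf 1}-\varrho_{\tilde\Gamma_{\mathcal G}^{\tilde f}}\lambda\in\tilde\Gamma\Big\}.$$ Then: (1) $\Gamma\subseteq\Gamma^t$ and $\Gamma_{\mathcal G}^f\subseteq{\Gamma^t}_{\mathcal G}^{f^t}$ for $t>1$; when $t=1$, $(f^t,\Gamma^t)$ coincides with $(f,\Gamma)$. (2) For each $t>1$, $(f^t,\Gamma^t)$ is a type 2 pair, i.e. $(0,\ldots,0,1)\in\mathring{\Gamma^t}_{\mathcal G}^{f^t}$. (3) $f^t(\lambda)\ge f(\lambda)$ for all $\lambda\in\Gamma$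 and all $t\ge1$.
   Context: $n\ge2$ and $\vec{\mathbf 1}=(1,\ldots,1)\in\mathbb R^n$. A pair $(f,\Gamma)$ consists of an open symmetric (permutation invariant) convex cone $\Gamma\subset\mathbb R^n$ with vertex at the origin, $\partial\Gamma\ne\emptyset$, $\Gamma_n:=\{\lambda\in\mathbb R^n:\text{each }\lambda_i>0\}\subseteq\Gamma$, and a smooth symmetric function $f:\Gamma\to\mathbb R$. For any pair $(h,K)$ (in particular for $(f,\Gamma)$, $(\tilde f,\tilde\Gamma)$, $(f^t,\Gamma^t)$) put $K_{\mathcal G}^h:=\{\lambda\in K:\lim_{s\to+\infty}h(s\lambda)>-\infty\}$, with interior $\mathring K_{\mathcal G}^h$ and boundary $\partial K_{\mathcal G}^h$, and define the constant $\varrho_{K_{\mathcal G}^h}$ by $(1,\ldots,1,1-\varrho_{K_{\mathcal G}^h})\in\partial K_{\mathcal G}^h$. The pair $(h,K)$ is of type 2 if $(0,\ldots,0,1)\in\mathring K_{\mathcal G}^h$, and of type 1 otherwise. The map $P$ is an invertible linear map since $0<\varrho<n$, so $\tilde f$ is well defined. *)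

theory Defs
  imports "HOL-Analysis.Analysis"
begin

text \<open>
  Vectors in \<open>\<real>\<^sup>n\<close> are elements of \<open>real ^ 'n\<close>, so \<open>vec 1\<close> is the vector \<open>(1,\<dots>,1)\<close>.
  The index type is not ordered; a parameter \<open>k :: 'n\<close> plays the role of the last index,
  so \<open>axis k 1\<close> is \<open>(0,\<dots>,0,1)\<close> and \<open>vec 1 - r *\<^sub>R axis k 1\<close> is \<open>(1,\<dots>,1,1-r)\<close>.
  A function on a set \<open>K\<close> is a total function of which only the values on \<open>K\<close> matter.
\<close>

definition pos_orthant :: "(real ^ 'n) set" where
  "pos_orthant = {x. \<forall>i. 0 < x $ i}"

definition permute_coords :: "('n \<Rightarrow> 'n) \<Rightarrow> real ^ 'n \<Rightarrow> real ^ 'n" where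
  "permute_coords p x = (\<chi> i. x $ p i)"

text \<open>\<open>C\<^sup>m\<close> regularity on an open set, by iterated directional derivatives.\<close>

primrec C_on :: "nat \<Rightarrow> (real ^ 'n) set \<Rightarrow> (real ^ 'n \<Rightarrow> real) \<Rightarrow> bool" where
  "C_on 0 S f \<longleftrightarrow> continuous_on S f"
| "C_on (Suc m) S f \<longleftrightarrow>
     (\<forall>x\<in>S. f differentiable (at x)) \<and> (\<forall>v. C_on m S (\<lambda>x. frechet_derivative f (at x) v))"

definition smooth_on :: "(real ^ 'n) set \<Rightarrow> (real ^ 'n \<Rightarrow> real) \<Rightarrow> bool" where
  "smooth_on S f \<longleftrightarrow> (\<forall>m. C_on m S f)"

definition partial_deriv :: "'n \<Rightarrow> (real ^ 'n \<Rightarrow> real) \<Rightarrow> real ^ 'n \<Rightarrow> real" where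
  "partial_deriv i f x = deriv (\<lambda>s. f (x + s *\<^sub>R axis i 1)) 0"

text \<open>
  The scaling condition is only for positive factors: the library's \<^const>\<open>cone\<close> would put
  the vertex into the open set \<open>K\<close>.
\<close>

definition symmetric_pair :: "(real ^ 'n \<Rightarrow> real) \<Rightarrow> (real ^ 'n) set \<Rightarrow> bool" where
  "symmetric_pair h K \<longleftrightarrow>
     open K \<and> convex K \<and> (\<forall>x\<in>K. \<forall>s>0. s *\<^sub>R x \<in> K) \<and> frontier K \<noteq> {} \<and> pos_orthant \<subseteq> K \<and>
     (\<forall>p. bij p \<longrightarrow> (\<forall>x\<in>K. permute_coords p x \<in> K)) \<and>
     (\<forall>p. bij p \<longrightarrow> (\<forall>x\<in>K. h (permute_coords p x) = h x)) \<and>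
     smooth_on K h"

text \<open>The limit along the ray is taken in the extended reals; membership entails its existence.\<close>

definition G_set :: "(real ^ 'n \<Rightarrow> real) \<Rightarrow> (real ^ 'n) set \<Rightarrow> (real ^ 'n) set" where
  "G_set h K = {x \<in> K. \<exists>L. ((\<lambda>s. ereal (h (s *\<^sub>R x))) \<longlongrightarrow> L) at_top \<and> L > - \<infinity>}"

definition type2_pair :: "'n \<Rightarrow> (real ^ 'n \<Rightarrow> real) \<Rightarrow> (real ^ 'n) set \<Rightarrow> bool" where
  "type2_pair k h K \<longleftrightarrow> symmetric_pair h K \<and> axis k 1 \<in> interior (G_set h K)"

definition type1_pair :: "'n \<Rightarrow> (real ^ 'n \<Rightarrow> real) \<Rightarrow> (real ^ 'n) set \<Rightarrow> bool" where
  "type1_pair k h K \<longleftrightarrow> symmetric_pair h K \<and> axis k 1 \<notin> interior (G_set h K)"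

definition rho_G :: "'n \<Rightarrow> (real ^ 'n \<Rightarrow> real) \<Rightarrow> (real ^ 'n) set \<Rightarrow> real" where
  "rho_G k h K = (THE r. vec 1 - r *\<^sub>R axis k 1 \<in> frontier (G_set h K))"

definition P_map :: "real \<Rightarrow> real ^ 'n \<Rightarrow> real ^ 'n" where
  "P_map \<rho> x = (\<Sum>j\<in>UNIV. x $ j) *\<^sub>R vec 1 - \<rho> *\<^sub>R x"

definition tilde_cone :: "real \<Rightarrow> (real ^ 'n) set \<Rightarrow> (real ^ 'n) set" where
  "tilde_cone \<rho> \<Gamma> = P_map \<rho> ` \<Gamma>"

text \<open>For \<open>0 < \<rho> < n\<close> the map \<^term>\<open>P_map \<rho>\<close> is bijective, so \<open>tilde_fun \<rho> f (P_map \<rho> x) = f x\<close>.\<close>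

definition tilde_fun :: "real \<Rightarrow> (real ^ 'n \<Rightarrow> real) \<Rightarrow> real ^ 'n \<Rightarrow> real" where
  "tilde_fun \<rho> f = f \<circ> inv (P_map \<rho>)"

definition family_map ::
  "'n \<Rightarrow> real \<Rightarrow> (real ^ 'n \<Rightarrow> real) \<Rightarrow> (real ^ 'n) set \<Rightarrow> real \<Rightarrow> real ^ 'n \<Rightarrow> real ^ 'n" where
  "family_map k \<rho> f \<Gamma> t x =
     (t * (\<Sum>i\<in>UNIV. x $ i)) *\<^sub>R vec 1 - rho_G k (tilde_fun \<rho> f) (tilde_cone \<rho> \<Gamma>) *\<^sub>R x"

definition family_fun ::
  "'n \<Rightarrow> real \<Rightarrow> (real ^ 'n \<Rightarrow> real) \<Rightarrow> (real ^ 'n) set \<Rightarrow> real \<Rightarrow> real ^ 'n \<Rightarrow> real" where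
  "family_fun k \<rho> f \<Gamma> t x = tilde_fun \<rho> f (family_map k \<rho> f \<Gamma> t x)"

definition family_cone ::
  "'n \<Rightarrow> real \<Rightarrow> (real ^ 'n \<Rightarrow> real) \<Rightarrow> (real ^ 'n) set \<Rightarrow> real \<Rightarrow> (real ^ 'n) set" where
  "family_cone k \<rho> f \<Gamma> t = {x. family_map k \<rho> f \<Gamma> t x \<in> tilde_cone \<rho> \<Gamma>}"

end

theory Submission
  imports Defs
begin

text \<open>
  Write \<open>\<sigma>(x)\<close> for the sum of the coordinates of \<open>x\<close>, \<open>e\<^sub>k\<close> for \<open>axis k 1\<close>, \<open>\<one>\<close> for \<open>vec 1\<close>, and
  \<open>G\<close> for \<open>G_set f \<Gamma>\<close>.

  The twofold change of variables hides a simple shear. The constant of the associated pair is \<open>\<rho>\<close>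
  itself: \<open>P_map \<rho>\<close> is injective and linear and carries \<open>G\<close> to the corresponding set of the
  associated pair, and \<open>\<one> - \<rho> e\<^sub>k\<close> is the image of \<open>e\<^sub>k\<close>, which lies on the boundary of \<open>G\<close>. Now
  \<open>t \<sigma>(x) \<one> - \<rho> x\<close> is the image under \<open>P_map \<rho>\<close> of
  \<open>x + c \<sigma>(x) \<one>\<close> with \<open>c = (t - 1) / (n - \<rho>)\<close>. Hence \<open>f\<^sup>t(x) = f (x + c \<sigma>(x) \<one>)\<close>, and \<open>\<Gamma>\<^sup>t\<close> is
  the preimage of \<open>\<Gamma>\<close> under this shear (lemma \<open>family_eq_shear\<close>). For \<open>t = 1\<close> the shear is the
  identity; for \<open>t > 1\<close> it moves every point of \<open>\<Gamma>\<close> in a positive direction, because \<open>\<sigma> > 0\<close> on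
  \<open>\<Gamma>\<close>. As \<open>f\<close> increases in every coordinate, all inclusions and inequalities follow, and \<open>e\<^sub>k\<close> is
  moved to \<open>e\<^sub>k + c \<one>\<close>, which has positive coordinates and so lies in the interior of \<open>G\<close>:
  this is type 2.

  Concavity enters through the rays. A concave function on a half line either is nondecreasing
  or tends to \<open>-\<infinity>\<close>; therefore \<open>x \<in> \<Gamma>\<close> belongs to \<open>G\<close> as soon as \<open>f\<close> is eventually bounded below
  on the ray through \<open>x\<close> (lemma \<open>G_set_iff\<close>), and the existence of the limit comes for free. This
  makes \<open>G\<close> a cone that is stable under adding positive vectors. Such a set has a very regular
  boundary: a point of the closure plus a positive vector is an interior point. Together
  with scaling, this gives the uniqueness of the boundary point on the line \<open>r \<mapsto> \<one> - r e\<^sub>k\<close>, both for \<open>G\<close> (lemma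
  \<open>rho_G_frontier\<close>) and for the associated pair (lemma \<open>rho_G_tilde\<close>).
\<close>

section \<open>Smoothness under linear substitutions\<close>

text \<open>
  Openness of \<open>S\<close> matters: the derivatives of \<open>f\<close> and \<open>g\<close> at a point of \<open>S\<close> are taken in the whole
  space, where the two functions may differ outside \<open>S\<close>.
\<close>

lemma C_on_cong:
  assumes "open S" and "\<And>x. x \<in> S \<Longrightarrow> f x = g x" and "C_on m S f"
  shows "C_on m S g"
  using assms(2,3)
proof (induction m arbitrary: f g)
  case 0
  then show ?case using continuous_on_cong[of S S f g] by simp
next
  case (Suc m)
  have D: "(g has_derivative frechet_derivative f (at x)) (at x)" if "x \<in> S" for x
  proof (rule has_derivative_transform_within_open[OF _ assms(1) that Suc.prems(1)])
    show "(f has_derivative frechet_derivative f (at x)) (at x)"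
      using Suc.prems(2) that by (simp add: frechet_derivative_works)
  qed
  have eq: "frechet_derivative g (at x) = frechet_derivative f (at x)" if "x \<in> S" for x
    using frechet_derivative_at[OF D[OF that]] by simp
  have "C_on m S (\<lambda>x. frechet_derivative g (at x) v)" for v
    by (rule Suc.IH[of "\<lambda>x. frechet_derivative f (at x) v"]) (use Suc.prems(2) eq in simp_all)
  moreover have "g differentiable (at x)" if "x \<in> S" for x
    using D[OF that] by (rule differentiableI)
  ultimately show ?case by simp
qed

text \<open>
  The directional derivative of \<open>f \<circ> L\<close> along \<open>v\<close> is that of \<open>f\<close> along the constant direction
  \<open>L v\<close>, composed with \<open>L\<close>; so it has again the form of the statement, with one order less.
\<close>

lemma C_on_compose_linear:
  fixes L :: "real ^ 'n \<Rightarrow> real ^ 'n"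
  assumes L: "linear L" and S: "open S" and "C_on m S f"
  shows "C_on m (L -` S) (\<lambda>x. f (L x))"
proof -
  have cont: "continuous_on A L" for A
    using L by (simp add: linear_continuous_on linear_conv_bounded_linear)
  show ?thesis using assms(3)
  proof (induction m arbitrary: f)
    case 0
    then have "continuous_on S f" by simp
    then have "continuous_on (L -` S) (\<lambda>x. f (L x))"
      by (rule continuous_on_compose2) (use cont in auto)
    then show ?case by simp
  next
    case (Suc m)
    have oS: "open (L -` S)"
      using S cont by (rule open_vimage)
    have D: "((\<lambda>x. f (L x)) has_derivative (\<lambda>v. frechet_derivative f (at (L x)) (L v))) (at x)"
      if "x \<in> L -` S" for x
    proof -
      have "(f has_derivative frechet_derivative f (at (L x))) (at (L x))"
        using Suc.prems that by (simp add: frechet_derivative_works)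
      from has_derivative_compose[OF linear_imp_has_derivative[OF L] this]
      show ?thesis .
    qed
    have "C_on m (L -` S) (\<lambda>x. frechet_derivative (\<lambda>x. f (L x)) (at x) v)" for v
    proof (rule C_on_cong[OF oS])
      show "C_on m (L -` S) (\<lambda>x. frechet_derivative f (at (L x)) (L v))"
        by (rule Suc.IH[of "\<lambda>x. frechet_derivative f (at x) (L v)"]) (use Suc.prems in simp)
      fix x assume "x \<in> L -` S"
      from frechet_derivative_at[OF D[OF this]]
      show "frechet_derivative f (at (L x)) (L v) = frechet_derivative (\<lambda>x. f (L x)) (at x) v"
        by (rule fun_cong)
    qed
    moreover have "(\<lambda>x. f (L x)) differentiable (at x)" if "x \<in> L -` S" for x
      using D[OF that] by (rule differentiableI)
    ultimately show ?case by simp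
  qed
qed

section \<open>Cones that absorb the positive orthant\<close>

lemma open_pos_orthant: "open (pos_orthant :: (real ^ 'n) set)"
proof -
  have "pos_orthant = (\<Inter>i\<in>UNIV. {x :: real ^ 'n. 0 < x $ i})"
    by (auto simp: pos_orthant_def)
  moreover have "open (\<Inter>i\<in>UNIV. {x :: real ^ 'n. 0 < x $ i})"
    by (intro open_INT finite ballI open_Collect_less continuous_intros)
  ultimately show ?thesis by simp
qed

text \<open>
  The points that exceed \<open>x\<close> in every coordinate form an open set. Each such point also exceeds all
  points of a neighbourhood of \<open>x\<close>, in particular one of \<open>G\<close>, and hence lies in \<open>G\<close>.
\<close>

lemma closure_plus_pos_orthant_subset_interior:
  fixes G :: "(real ^ 'n) set"
  assumes up: "\<And>x y. x \<in> G \<Longrightarrow> y \<in> pos_orthant \<Longrightarrow> x + y \<in> G"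
    and x: "x \<in> closure G" and y: "y \<in> pos_orthant"
  shows "x + y \<in> interior G"
proof -
  let ?U = "(\<lambda>z. z - x) -` pos_orthant :: (real ^ 'n) set"
  have "?U \<subseteq> G"
  proof
    fix z assume z: "z \<in> ?U"
    \<comment> \<open>the points below \<open>z\<close>: a neighbourhood of \<open>x\<close>, so it meets \<open>G\<close>\<close>
    let ?V = "(\<lambda>w. z - w) -` pos_orthant :: (real ^ 'n) set"
    have "open ?V" 
      by (intro open_vimage open_pos_orthant continuous_intros)
    moreover have "x \<in> ?V" using z by simp
    ultimately obtain w where "w \<in> G" "w \<in> ?V"
      using x by (auto simp: closure_iff_nhds_not_empty) 
    then show "z \<in> G"
      using up[of w "z - w"] by simp
  qed
  moreover have "open ?U"
    by (intro open_vimage open_pos_orthant continuous_intros)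
  moreover have "x + y \<in> ?U" using y by simp
  ultimately show ?thesis by (rule interiorI[rotated 2])
qed

section \<open>Symmetric cones\<close>

text \<open>
  An open set containing the vertex and closed under positive scaling is the whole space, which
  has no boundary.
\<close>

lemma symmetric_pair_zero_notin:
  assumes "symmetric_pair h K"
  shows "0 \<notin> K"
proof
  assume "0 \<in> K"
  moreover have "open K" using assms by (simp add: symmetric_pair_def)
  ultimately obtain e where e: "e > 0" "ball 0 e \<subseteq> K"
    by (meson openE)
  have "x \<in> K" for x
  proof (cases "x = 0")
    case False
    then have "(e / (2 * norm x)) *\<^sub>R x \<in> K"
      using e by (intro subsetD[OF e(2)]) auto
    then have "(2 * norm x / e) *\<^sub>R ((e / (2 * norm x)) *\<^sub>R x) \<in> K"
      using assms e False by (auto simp: symmetric_pair_def simp del: scaleR_scaleR)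
    then show ?thesis using e False by simp
  qed (use \<open>0 \<in> K\<close> in simp)
  then have "K = UNIV" by auto
  then show False using assms by (auto simp: symmetric_pair_def)
qed

lemma convex_cone_add:
  assumes "convex K" "\<forall>x\<in>K. \<forall>s>0. s *\<^sub>R x \<in> K" "x \<in> K" "y \<in> K"
  shows "x + y \<in> K"
proof -
  have "(1/2) *\<^sub>R x + (1/2) *\<^sub>R y \<in> K"
    using assms by (intro convexD) auto
  then have "(2::real) *\<^sub>R ((1/2) *\<^sub>R x + (1/2) *\<^sub>R y) \<in> K"
    using assms(2) by (simp del: scaleR_scaleR)
  then show ?thesis by (simp add: scaleR_add_right)
qed

lemma convex_cone_sum:
  assumes "convex K" "\<forall>x\<in>K. \<forall>s>0. s *\<^sub>R x \<in> K" "finite I" "I \<noteq> {}" "\<And>i. i \<in> I \<Longrightarrow> g i \<in> K"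
  shows "sum g I \<in> K"
  using assms(3-5)
proof (induction I rule: finite_ne_induct)
  case (insert i I)
  then have "g i + sum g I \<in> K" by (intro convex_cone_add assms(1,2)) auto
  then show ?case using insert by simp
qed simp

text \<open>
  The sum over all permutations is itself invariant under transpositions of coordinates, hence a
  multiple of \<open>vec 1\<close>; comparing coordinate sums shows which one.
\<close>

lemma sum_permute_coords:
  fixes x :: "real ^ 'n"
  obtains c :: real where "c > 0"
    "(\<Sum>p | bij p. permute_coords p x) = (c * (\<Sum>i\<in>UNIV. x $ i)) *\<^sub>R vec 1"
proof -
  let ?B = "{p :: 'n \<Rightarrow> 'n. bij p}"
  let ?S = "\<Sum>p\<in>?B. permute_coords p x"
  have comp: "?S $ i = (\<Sum>p\<in>?B. x $ p i)" for i
    by (simp add: permute_coords_def)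
  have const: "?S $ i = ?S $ j" for i j
    unfolding comp
    \<comment> \<open>swapping \<open>i\<close> and \<open>j\<close> first is an involution on the permutations\<close>
    by (rule sum.reindex_bij_witness[of _ "\<lambda>p. p \<circ> Transposition.transpose i j" "\<lambda>p. p \<circ> Transposition.transpose i j"])
       (auto simp: o_assoc[symmetric] intro: bij_comp)
  have "(\<Sum>i\<in>UNIV. ?S $ i) = (\<Sum>p\<in>?B. \<Sum>i\<in>UNIV. x $ p i)"
    unfolding comp by (rule sum.swap)
  also have "\<dots> = (\<Sum>p\<in>?B. \<Sum>i\<in>UNIV. x $ i)"
    by (intro sum.cong refl sum.reindex_bij_betw) simp
  also have "\<dots> = card ?B * (\<Sum>i\<in>UNIV. x $ i)" by simp
  finally have total: "(\<Sum>i\<in>UNIV. ?S $ i) = card ?B * (\<Sum>i\<in>UNIV. x $ i)" .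
  have "CARD('n) * ?S $ j = card ?B * (\<Sum>i\<in>UNIV. x $ i)" for j
  proof -
    have "(\<Sum>i\<in>UNIV. ?S $ i) = (\<Sum>i\<in>(UNIV :: 'n set). ?S $ j)"
      by (intro sum.cong refl const)
    then show ?thesis using total by simp
  qed
  then have "?S = (card ?B / CARD('n) * (\<Sum>i\<in>UNIV. x $ i)) *\<^sub>R vec 1"
    by (simp add: vec_eq_iff field_simps)
  moreover have "card ?B > 0"
    using bij_id by (auto simp: card_gt_0_iff)
  ultimately show ?thesis
    by (intro that[of "card ?B / CARD('n)"]) simp_all
qed

lemma sum_axis: "(\<Sum>i\<in>UNIV. axis k (a::real) $ i) = a"
  by (simp add: axis_def)

text \<open>
  Averaging over the permutations puts a vector \<open>a \<one>\<close> into the cone, where \<open>a\<close> has the sign of the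
  coordinate sum. If \<open>a\<close> were not positive, adding the positive vector \<open>-a \<one>\<close> (when \<open>a < 0\<close>) would
  place the vertex in the cone.
\<close>

lemma symmetric_pair_sum_pos:
  fixes x :: "real ^ 'n"
  assumes K: "symmetric_pair h K" and x: "x \<in> K"
  shows "0 < (\<Sum>i\<in>UNIV. x $ i)"
proof (rule ccontr)
  assume neg: "\<not> ?thesis"
  obtain c :: real where c: "c > 0"
    "(\<Sum>p | bij p. permute_coords p x) = (c * (\<Sum>i\<in>UNIV. x $ i)) *\<^sub>R vec 1"
    by (rule sum_permute_coords)
  let ?a = "c * (\<Sum>i\<in>UNIV. x $ i)"
  have K': "convex K" "\<forall>x\<in>K. \<forall>s>0. s *\<^sub>R x \<in> K" "pos_orthant \<subseteq> K"
    using K by (auto simp: symmetric_pair_def)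
  have "(\<Sum>p | bij p. permute_coords p x) \<in> K"
    using K x bij_id by (intro convex_cone_sum K') (auto simp: symmetric_pair_def)
  then have a: "?a *\<^sub>R vec 1 \<in> K" using c by simp
  have "?a \<le> 0" using neg c by (simp add: mult_le_0_iff)
  show False
  proof (cases "?a = 0")
    case True
    then show False using a symmetric_pair_zero_notin[OF K] by (simp only: scaleR_zero_left)
  next
    case False
    then have "?a < 0" using \<open>?a \<le> 0\<close> by linarith
    then have "(- ?a) *\<^sub>R vec 1 \<in> K"
      by (intro subsetD[OF K'(3)]) (simp add: pos_orthant_def)
    from convex_cone_add[OF K'(1,2) a this] show False
      using symmetric_pair_zero_notin[OF K] by simp
  qed
qed

section \<open>Increasing concave symmetric functions\<close>

locale increasing_concave_pair =
  fixes f :: "real ^ 'n \<Rightarrow> real" and \<Gamma> :: "(real ^ 'n) set"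
  assumes pair: "symmetric_pair f \<Gamma>"
    and concave: "concave_on \<Gamma> f"
    and partial_pos: "\<And>x i. x \<in> \<Gamma> \<Longrightarrow> 0 < partial_deriv i f x"
begin

lemma open_\<Gamma>: "open \<Gamma>" and convex_\<Gamma>: "convex \<Gamma>"
  and scale_\<Gamma>: "x \<in> \<Gamma> \<Longrightarrow> 0 < s \<Longrightarrow> s *\<^sub>R x \<in> \<Gamma>"
  and pos_\<Gamma>: "pos_orthant \<subseteq> \<Gamma>"
  and permute_\<Gamma>: "bij p \<Longrightarrow> x \<in> \<Gamma> \<Longrightarrow> permute_coords p x \<in> \<Gamma>"
  and permute_f: "bij p \<Longrightarrow> x \<in> \<Gamma> \<Longrightarrow> f (permute_coords p x) = f x"
  and smooth_f: "smooth_on \<Gamma> f"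
  using pair by (auto simp: symmetric_pair_def)

lemma add_\<Gamma>: "x \<in> \<Gamma> \<Longrightarrow> y \<in> \<Gamma> \<Longrightarrow> x + y \<in> \<Gamma>"
  using convex_cone_add convex_\<Gamma> scale_\<Gamma> by blast

lemma deriv_f:
  assumes "x \<in> \<Gamma>"
  shows "(f has_derivative frechet_derivative f (at x)) (at x)"
proof -
  have "C_on (Suc 0) \<Gamma> f" using smooth_f unfolding smooth_on_def by blast
  then show ?thesis using assms by (simp add: frechet_derivative_works)
qed

lemma partial_deriv_eq:
  assumes "x \<in> \<Gamma>"
  shows "partial_deriv i f x = frechet_derivative f (at x) (axis i 1)"
proof -
  let ?D = "frechet_derivative f (at x)"
  have "((\<lambda>s. x + s *\<^sub>R axis i 1) has_derivative (\<lambda>s. s *\<^sub>R axis i 1)) (at (0::real))"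
    by (auto intro!: derivative_eq_intros)
  from has_derivative_compose[OF this, of f ?D] deriv_f[OF assms]
  have "((\<lambda>s. f (x + s *\<^sub>R axis i 1)) has_derivative (\<lambda>s. ?D (s *\<^sub>R axis i 1))) (at 0)"
    by simp
  moreover have "?D (s *\<^sub>R axis i 1) = ?D (axis i 1) * s" for s
    using linear_scale[OF has_derivative_linear[OF deriv_f[OF assms]]] by simp
  ultimately have "((\<lambda>s. f (x + s *\<^sub>R axis i 1)) has_real_derivative ?D (axis i 1)) (at 0)"
    by (simp add: has_field_derivative_def)
  then show ?thesis by (simp add: partial_deriv_def DERIV_imp_deriv)
qed

text \<open>
  Along the segment from \<open>x\<close> to \<open>x + v\<close> the derivative is \<open>\<Sum>i. v\<^sub>i \<partial>\<^sub>i f\<close>, a combination with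
  nonnegative coefficients.
\<close>

lemma mono_f:
  assumes x: "x \<in> \<Gamma>" and v: "v \<in> pos_orthant"
  shows "f x \<le> f (x + v)"
proof -
  have mem: "x + s *\<^sub>R v \<in> \<Gamma>" if "0 \<le> s" for s
    using that x v pos_\<Gamma> by (cases "s = 0") (auto intro!: add_\<Gamma> scale_\<Gamma>)
  have "f (x + 0 *\<^sub>R v) \<le> f (x + 1 *\<^sub>R v)"
  proof (rule DERIV_nonneg_imp_nondecreasing[of 0 1 "\<lambda>s. f (x + s *\<^sub>R v)"])
    fix s :: real assume "0 \<le> s" "s \<le> 1"
    let ?y = "x + s *\<^sub>R v"
    let ?D = "frechet_derivative f (at ?y)"
    have y: "?y \<in> \<Gamma>" using mem \<open>0 \<le> s\<close> .
    note lin = has_derivative_linear[OF deriv_f[OF y]]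
    have "((\<lambda>s. x + s *\<^sub>R v) has_derivative (\<lambda>s. s *\<^sub>R v)) (at s)"
      by (auto intro!: derivative_eq_intros)
    from has_derivative_compose[OF this deriv_f[OF y]]
    have "((\<lambda>s. f (x + s *\<^sub>R v)) has_real_derivative ?D v) (at s)"
      by (rule has_derivative_imp_has_field_derivative) (simp add: linear_scale[OF lin])
    moreover have "?D v \<ge> 0"
    proof -
      have "v = (\<Sum>i\<in>UNIV. v $ i *\<^sub>R axis i 1)"
        using basis_expansion[of v] by (simp add: scalar_mult_eq_scaleR)
      then have "?D v = ?D (\<Sum>i\<in>UNIV. v $ i *\<^sub>R axis i 1)" by simp
      also have "\<dots> = (\<Sum>i\<in>UNIV. v $ i * partial_deriv i f ?y)"
        by (simp add: linear_sum[OF lin] linear_scale[OF lin] partial_deriv_eq[OF y])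
      also have "\<dots> \<ge> 0"
        using v partial_pos[OF y] by (intro sum_nonneg) (simp add: pos_orthant_def less_imp_le)
      finally show ?thesis .
    qed
    ultimately show "\<exists>d. ((\<lambda>s. f (x + s *\<^sub>R v)) has_real_derivative d) (at s) \<and> 0 \<le> d"
      by blast
  qed simp
  then show ?thesis by simp
qed

text \<open>
  If the concave function \<open>s \<mapsto> f (s x)\<close> ever decreased, it would stay below the descending secant
  line from then on and tend to \<open>-\<infinity>\<close>.
\<close>

lemma mono_ray:
  assumes x: "x \<in> \<Gamma>" and bdd: "\<forall>\<^sub>F s in at_top. B \<le> f (s *\<^sub>R x)"
    and st: "0 < s" "s < t"
  shows "f (s *\<^sub>R x) \<le> f (t *\<^sub>R x)"
proof (rule ccontr)
  assume neg: "\<not> ?thesis"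
  define d where "d = (f (s *\<^sub>R x) - f (t *\<^sub>R x)) / (t - s)"
  have d: "d > 0" using neg st by (simp add: d_def)
  \<comment> \<open>Beyond \<open>t\<close> the function lies below the secant through \<open>s\<close> and \<open>t\<close>, whose slope is \<open>- d\<close>.\<close>
  have upper: "f (u *\<^sub>R x) \<le> f (t *\<^sub>R x) - d * (u - t)" if u: "u > t" for u
  proof -
    \<comment> \<open>the weight that makes \<open>t\<close> a convex combination of \<open>s\<close> and \<open>u\<close>\<close>
    define a where "a = (t - s) / (u - s)"
    have a: "0 < a" "a < 1" using st u by (auto simp: a_def)
    have au: "a * (u - s) = t - s" using st u by (simp add: a_def)
    then have at: "(1 - a) * s + a * u = t" by (simp add: algebra_simps)
    have "(1 - a) * f (s *\<^sub>R x) + a * f (u *\<^sub>R x) \<le> f ((1 - a) *\<^sub>R s *\<^sub>R x + a *\<^sub>R u *\<^sub>R x)"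
      using st u a x scale_\<Gamma> by (intro concave_onD[OF concave]) auto
    also have "(1 - a) *\<^sub>R s *\<^sub>R x + a *\<^sub>R u *\<^sub>R x = t *\<^sub>R x"
      by (simp add: at[symmetric] scaleR_add_left)
    finally have "(u - s) * ((1 - a) * f (s *\<^sub>R x) + a * f (u *\<^sub>R x)) \<le> (u - s) * f (t *\<^sub>R x)"
      using st u by (intro mult_left_mono) auto
    moreover have "(u - s) * a = t - s" "(u - s) * (1 - a) = u - t"
      using au by (simp_all add: algebra_simps)
    ultimately have "(u - t) * f (s *\<^sub>R x) + (t - s) * f (u *\<^sub>R x) \<le> (u - s) * f (t *\<^sub>R x)"
      by (simp only: distrib_left mult.assoc[symmetric])
    then show ?thesis using st u by (simp add: d_def field_simps)
  qed
  have "\<forall>\<^sub>F u in at_top. u > t \<and> u > t + (f (t *\<^sub>R x) - B) / d \<and> B \<le> f (u *\<^sub>R x)"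
    using bdd by (intro eventually_conj eventually_gt_at_top)
  then obtain u where "u > t" "u > t + (f (t *\<^sub>R x) - B) / d" "B \<le> f (u *\<^sub>R x)"
    using eventually_happens'[OF trivial_limit_at_top_linorder] by blast
  then show False using upper[of u] d by (simp add: field_simps)
qed

text \<open>
  By monotonicity along the ray, an eventual lower bound is enough for the limit in the extended
  reals to exist (it is a supremum) and to exceed \<open>-\<infinity>\<close>. This frees all later arguments from limits.
\<close>

lemma G_set_iff:
  "x \<in> G_set f \<Gamma> \<longleftrightarrow> x \<in> \<Gamma> \<and> (\<exists>B. \<forall>\<^sub>F s in at_top. B \<le> f (s *\<^sub>R x))"
proof (intro iffI conjI)
  assume "x \<in> G_set f \<Gamma>"
  then obtain L where x: "x \<in> \<Gamma>" and L: "((\<lambda>s. ereal (f (s *\<^sub>R x))) \<longlongrightarrow> L) at_top" "L > - \<infinity>"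
    by (auto simp: G_set_def)
  then obtain B where "ereal B < L" using ereal_dense2 by blast
  from order_tendstoD(1)[OF L(1) this]
  have "\<forall>\<^sub>F s in at_top. B \<le> f (s *\<^sub>R x)" by eventually_elim simp
  then show "\<exists>B. \<forall>\<^sub>F s in at_top. B \<le> f (s *\<^sub>R x)" ..
  show "x \<in> \<Gamma>" by fact
next
  assume "x \<in> \<Gamma> \<and> (\<exists>B. \<forall>\<^sub>F s in at_top. B \<le> f (s *\<^sub>R x))"
  then obtain B where x: "x \<in> \<Gamma>" and B: "\<forall>\<^sub>F s in at_top. B \<le> f (s *\<^sub>R x)" by blast
  let ?L = "SUP s\<in>{0<..}. ereal (f (s *\<^sub>R x))"
  have "((\<lambda>s. ereal (f (s *\<^sub>R x))) \<longlongrightarrow> ?L) at_top"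
  proof (rule increasing_tendsto)
    show "\<forall>\<^sub>F s in at_top. ereal (f (s *\<^sub>R x)) \<le> ?L"
      using eventually_gt_at_top[of 0] by eventually_elim (auto intro: SUP_upper)
    fix y assume "y < ?L"
    then obtain s where s: "s > 0" "y < ereal (f (s *\<^sub>R x))" by (auto simp: less_SUP_iff)
    show "\<forall>\<^sub>F t in at_top. y < ereal (f (t *\<^sub>R x))"
      using eventually_gt_at_top[of s]
    proof eventually_elim
      case (elim t)
      then show ?case
        using mono_ray[OF x B s(1) elim] s(2) by (meson ereal_less_eq(3) less_le_trans)
    qed
  qed
  moreover have "?L > - \<infinity>"
    using SUP_upper[of 1 "{0<..}" "\<lambda>s. ereal (f (s *\<^sub>R x))"] by (auto simp: less_le_trans)
  ultimately show "x \<in> G_set f \<Gamma>" using x by (auto simp: G_set_def)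
qed

lemma G_set_up:
  assumes x: "x \<in> G_set f \<Gamma>" and v: "v \<in> pos_orthant"
  shows "x + v \<in> G_set f \<Gamma>"
proof -
  from x obtain B where "x \<in> \<Gamma>" and B: "\<forall>\<^sub>F s in at_top. B \<le> f (s *\<^sub>R x)"
    by (auto simp: G_set_iff)
  have "\<forall>\<^sub>F s in at_top. B \<le> f (s *\<^sub>R (x + v))"
    using B eventually_gt_at_top[of 0]
  proof eventually_elim
    case (elim s)
    have "f (s *\<^sub>R x) \<le> f (s *\<^sub>R x + s *\<^sub>R v)"
      using elim v \<open>x \<in> \<Gamma>\<close> by (intro mono_f scale_\<Gamma>) (auto simp: pos_orthant_def)
    then show ?case using elim by (simp add: scaleR_add_right)
  qed
  then show ?thesis using \<open>x \<in> \<Gamma>\<close> v pos_\<Gamma> by (auto simp: G_set_iff intro: add_\<Gamma>)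
qed

lemma G_set_scale:
  assumes x: "x \<in> G_set f \<Gamma>" and r: "0 < r"
  shows "r *\<^sub>R x \<in> G_set f \<Gamma>"
proof -
  from x obtain B where "x \<in> \<Gamma>" and B: "\<forall>\<^sub>F s in at_top. B \<le> f (s *\<^sub>R x)"
    by (auto simp: G_set_iff)
  have "filterlim (\<lambda>s. s * r) at_top at_top"
    using r by (simp add: filterlim_at_top_mult_tendsto_pos[OF tendsto_const] filterlim_ident mult.commute)
  from eventually_compose_filterlim[OF B this] 
  show ?thesis using \<open>x \<in> \<Gamma>\<close> r by (auto simp: G_set_iff intro: scale_\<Gamma>)
qed

lemma pos_orthant_subset_G_set: "pos_orthant \<subseteq> G_set f \<Gamma>"
proof
  fix v :: "real ^ 'n" assume v: "v \<in> pos_orthant"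
  have "\<forall>\<^sub>F s in at_top. f v \<le> f (s *\<^sub>R v)"
    using eventually_gt_at_top[of 1]
  proof eventually_elim
    case (elim s)
    have "f v \<le> f (v + (s - 1) *\<^sub>R v)"
      using elim v pos_\<Gamma> by (intro mono_f) (auto simp: pos_orthant_def)
    then show ?case by (simp add: scaleR_diff_left)
  qed
  then show "v \<in> G_set f \<Gamma>" using v pos_\<Gamma> by (auto simp: G_set_iff)
qed

lemma pos_orthant_subset_interior_G_set: "pos_orthant \<subseteq> interior (G_set f \<Gamma>)"
  by (intro interior_maximal pos_orthant_subset_G_set open_pos_orthant)

lemma closure_G_set_plus_pos:
  "x \<in> closure (G_set f \<Gamma>) \<Longrightarrow> v \<in> pos_orthant \<Longrightarrow> x + v \<in> interior (G_set f \<Gamma>)"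
  by (rule closure_plus_pos_orthant_subset_interior[OF G_set_up])

lemma closure_G_set_scale:
  assumes "x \<in> closure (G_set f \<Gamma>)" and "0 < r"
  shows "r *\<^sub>R x \<in> closure (G_set f \<Gamma>)"
proof -
  have "r *\<^sub>R x \<in> (\<lambda>x. r *\<^sub>R x) ` closure (G_set f \<Gamma>)" using assms by blast
  also have "\<dots> = closure ((\<lambda>x. r *\<^sub>R x) ` G_set f \<Gamma>)" by (rule closure_scaleR)
  also have "\<dots> \<subseteq> closure (G_set f \<Gamma>)"
    using assms G_set_scale by (intro closure_mono) auto
  finally show ?thesis .
qed

lemma interior_G_set_scale:
  assumes "x \<in> interior (G_set f \<Gamma>)" and "0 < r"
  shows "r *\<^sub>R x \<in> interior (G_set f \<Gamma>)"
proof -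
  have "r *\<^sub>R x \<in> (\<lambda>x. r *\<^sub>R x) ` interior (G_set f \<Gamma>)" using assms by blast
  also have "\<dots> = interior ((\<lambda>x. r *\<^sub>R x) ` G_set f \<Gamma>)"
    using assms by (intro interior_injective_linear_image[symmetric])
      (auto simp: linear_iff scaleR_add_right inj_on_def)
  also have "\<dots> \<subseteq> interior (G_set f \<Gamma>)"
    using assms G_set_scale by (intro interior_mono) auto
  finally show ?thesis .
qed

text \<open>
  For \<open>s < 1\<close> the point with parameter \<open>s\<close> is itself positive. Otherwise it lies strictly between \<open>\<one>\<close>
  and the point with parameter \<open>r\<close>, hence is the sum of a point of the closure and a positive vector.
\<close>

lemma corner_interior:
  assumes r: "vec 1 - r *\<^sub>R axis k 1 \<in> closure (G_set f \<Gamma>)" and s: "s < r"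
  shows "vec 1 - s *\<^sub>R axis k 1 \<in> interior (G_set f \<Gamma>)"
proof (cases "s < 1")
  \<comment> \<open>This case covers \<open>s \<le> 0\<close> and \<open>r \<le> 0\<close>, where the division by \<open>r\<close> below is of no use.\<close>
  case True
  then have "vec 1 - s *\<^sub>R axis k 1 \<in> pos_orthant"
    by (auto simp: pos_orthant_def axis_def)
  then show ?thesis using pos_orthant_subset_interior_G_set by blast
next
  case False
  then have "(s / r) *\<^sub>R (vec 1 - r *\<^sub>R axis k 1) + (1 - s / r) *\<^sub>R vec 1 \<in> interior (G_set f \<Gamma>)"
    using s by (intro closure_G_set_plus_pos closure_G_set_scale r) (auto simp: pos_orthant_def)
  also have "(s / r) *\<^sub>R (vec 1 - r *\<^sub>R axis k 1) + (1 - s / r) *\<^sub>R vec 1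
      = (vec 1 - s *\<^sub>R axis k 1 :: real ^ 'n)"
    unfolding vec_eq_iff using False s by (simp add: right_diff_distrib)
  finally show ?thesis .
qed

text \<open>
  The constant of a pair is defined by a definite description, so existence and uniqueness of the
  boundary point have to be shown. The segment from \<open>\<one>\<close> (inside \<open>G\<close>) to \<open>\<one> - n e\<^sub>k\<close> (coordinate
  sum 0, so outside \<open>\<Gamma>\<close>) is connected and must meet the boundary; two boundary points on the
  line are impossible, since the one with the smaller parameter would be interior.
\<close>

lemma rho_G_frontier: "vec 1 - rho_G k f \<Gamma> *\<^sub>R axis k 1 \<in> frontier (G_set f \<Gamma>)"
proof -
  let ?G = "G_set f \<Gamma>" and ?p = "\<lambda>r. vec 1 - r *\<^sub>R axis k 1 :: real ^ 'n"
  let ?n = "real CARD('n)"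
  have conn: "connected (?p ` {0..?n})"
    by (intro connected_continuous_image continuous_intros) simp
  have "?p 0 \<in> ?G" using pos_orthant_subset_G_set by (auto simp: pos_orthant_def)
  moreover have "(\<Sum>i\<in>UNIV. ?p ?n $ i) = 0"
    by (simp add: sum_subtractf sum_distrib_left[symmetric] sum_axis)
  then have "?p ?n \<notin> ?G"
    using symmetric_pair_sum_pos[OF pair, of "?p ?n"] by (auto simp: G_set_def)
  ultimately have "?p 0 \<in> ?p ` {0..?n} \<inter> ?G" "?p ?n \<in> ?p ` {0..?n} - ?G" by auto
  then have "?p ` {0..?n} \<inter> frontier ?G \<noteq> {}"
    by (intro connected_Int_frontier conn) blast+
  then obtain r where r: "?p r \<in> frontier ?G" by auto
  have "\<not> a < b" if "?p a \<in> frontier ?G" "?p b \<in> frontier ?G" for a b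
    using that corner_interior[of b k a] by (auto simp: frontier_def)
  then have "\<exists>!r. ?p r \<in> frontier ?G" using r by (meson linorder_neqE)
  then show ?thesis unfolding rho_G_def by (rule theI')
qed

lemma below_rho_G_interior:
  "s < rho_G k f \<Gamma> \<Longrightarrow> vec 1 - s *\<^sub>R axis k 1 \<in> interior (G_set f \<Gamma>)"
  using corner_interior rho_G_frontier by (auto simp: frontier_def)

end

section \<open>The associated pair\<close>

lemma linear_P_map: "linear (P_map \<rho>)"
  by (intro linearI) (simp_all add: P_map_def sum.distrib sum_distrib_left vec_eq_iff algebra_simps)

lemma sum_P_map:
  fixes x :: "real ^ 'n"
  shows "(\<Sum>i\<in>UNIV. P_map \<rho> x $ i) = (real CARD('n) - \<rho>) * (\<Sum>i\<in>UNIV. x $ i)"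
  by (simp add: P_map_def sum_subtractf sum_distrib_left[symmetric] algebra_simps)

lemma inj_P_map:
  assumes "0 < \<rho>" "\<rho> < real CARD('n)"
  shows "inj (P_map \<rho> :: real ^ 'n \<Rightarrow> real ^ 'n)"
proof (subst linear_injective_0[OF linear_P_map], intro allI impI)
  fix x :: "real ^ 'n" assume x: "P_map \<rho> x = 0"
  then have "(\<Sum>i\<in>UNIV. x $ i) = 0" using sum_P_map[of \<rho> x] assms by simp
  then show "x = 0" using x assms by (simp add: P_map_def)
qed

lemma G_set_tilde:
  fixes f :: "real ^ 'n \<Rightarrow> real"
  assumes "inj (P_map \<rho> :: real ^ 'n \<Rightarrow> real ^ 'n)"
  shows "G_set (tilde_fun \<rho> f) (tilde_cone \<rho> \<Gamma>) = P_map \<rho> ` G_set f \<Gamma>"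
proof -
  have "tilde_fun \<rho> f (s *\<^sub>R P_map \<rho> x) = f (s *\<^sub>R x)" for s x
    by (simp add: tilde_fun_def linear_scale[OF linear_P_map, symmetric] inv_f_f[OF assms])
  then have "P_map \<rho> x \<in> G_set (tilde_fun \<rho> f) (tilde_cone \<rho> \<Gamma>) \<longleftrightarrow> x \<in> G_set f \<Gamma>" for x
    by (simp add: G_set_def tilde_cone_def inj_image_mem_iff[OF assms])
  moreover have "G_set (tilde_fun \<rho> f) (tilde_cone \<rho> \<Gamma>) \<subseteq> range (P_map \<rho>)"
    by (auto simp: G_set_def tilde_cone_def)
  ultimately show ?thesis by blast
qed

lemma frontier_injective_linear_image:
  fixes L :: "'a::euclidean_space \<Rightarrow> 'a"
  assumes "linear L" "inj L"
  shows "frontier (L ` S) = L ` frontier S"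
  using assms
  by (simp add: frontier_def closure_injective_linear_image interior_injective_linear_image
      image_set_diff)

text \<open>
  The preimage of \<open>\<one> - r e\<^sub>k\<close> under \<open>P_map \<rho>\<close>. At \<open>r = \<rho>\<close> the multiple of \<open>\<one>\<close> vanishes and
  only a multiple of \<open>e\<^sub>k\<close> remains; the sign of the first term distinguishes the cases \<open>r < \<rho>\<close> and \<open>r > \<rho>\<close>.
\<close>

lemma P_map_preimage:
  fixes k :: "'n :: finite"
  assumes "0 < \<rho>" "\<rho> < real CARD('n)"
  shows "P_map \<rho> ((1 / \<rho>) *\<^sub>R (((\<rho> - r) / (real CARD('n) - \<rho>)) *\<^sub>R vec 1 + r *\<^sub>R axis k 1))
    = vec 1 - r *\<^sub>R axis k 1"
proof -
  let ?n = "real CARD('n)"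
  have "(\<Sum>i\<in>UNIV. (((\<rho> - r) / (?n - \<rho>)) *\<^sub>R vec 1 + r *\<^sub>R axis k 1 :: real ^ 'n) $ i)
    = ?n * ((\<rho> - r) / (?n - \<rho>)) + r"
    by (simp add: sum.distrib sum_distrib_left[symmetric] sum_axis)
  moreover have "(?n * ((\<rho> - r) / (?n - \<rho>)) + r) - \<rho> * ((\<rho> - r) / (?n - \<rho>)) = \<rho>"
  proof -
    have "(?n * ((\<rho> - r) / (?n - \<rho>)) + r) - \<rho> * ((\<rho> - r) / (?n - \<rho>))
      = (?n - \<rho>) * ((\<rho> - r) / (?n - \<rho>)) + r" by (simp only: left_diff_distrib)
    then show ?thesis using assms by simp
  qed
  ultimately have "P_map \<rho> (((\<rho> - r) / (?n - \<rho>)) *\<^sub>R vec 1 + r *\<^sub>R axis k 1)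
    = \<rho> *\<^sub>R (vec 1 - r *\<^sub>R axis k 1 :: real ^ 'n)"
    by (simp add: P_map_def vec_eq_iff algebra_simps)
  then show ?thesis
    using assms by (simp add: linear_scale[OF linear_P_map])
qed

context increasing_concave_pair
begin

text \<open>
  By lemma \<open>P_map_preimage\<close> one has to decide for which \<open>r\<close> the vector \<open>a \<one> + r e\<^sub>k\<close>, with
  \<open>a = (\<rho> - r) / (n - \<rho>)\<close>, is on the boundary of \<open>G\<close>. For \<open>r = \<rho>\<close> it is \<open>\<rho> e\<^sub>k\<close>, on the boundary
  by assumption. For \<open>r < \<rho>\<close> it is a positive multiple of \<open>\<one> - s e\<^sub>k\<close> with \<open>s = - r / a\<close>, and
  \<open>s < n - \<rho> < rho_G k f \<Gamma>\<close> makes it interior; this is what the lower bound on \<open>\<rho>\<close> is for. For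
  \<open>r > \<rho>\<close> the coefficient \<open>a\<close> is negative: were the vector in the closure, adding \<open>-a \<one>\<close> would make
  \<open>r e\<^sub>k\<close>, and with it \<open>e\<^sub>k\<close>, an interior point.
\<close>

lemma rho_G_tilde:
  fixes k :: 'n
  assumes e: "axis k 1 \<in> frontier (G_set f \<Gamma>)"
    and \<rho>: "0 < \<rho>" "real CARD('n) - rho_G k f \<Gamma> < \<rho>" "\<rho> < real CARD('n)"
  shows "rho_G k (tilde_fun \<rho> f) (tilde_cone \<rho> \<Gamma>) = \<rho>"
proof -
  let ?G = "G_set f \<Gamma>" and ?n = "real CARD('n)"
  let ?a = "\<lambda>r. (\<rho> - r) / (?n - \<rho>)"
  let ?q = "\<lambda>r. (1 / \<rho>) *\<^sub>R (?a r *\<^sub>R vec 1 + r *\<^sub>R axis k 1) :: real ^ 'n"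
  note inj = inj_P_map[OF \<rho>(1,3)]
  have tilde: "vec 1 - r *\<^sub>R axis k 1 \<in> frontier (G_set (tilde_fun \<rho> f) (tilde_cone \<rho> \<Gamma>))
      \<longleftrightarrow> ?q r \<in> frontier ?G" for r
    unfolding G_set_tilde[OF inj] frontier_injective_linear_image[OF linear_P_map inj]
      P_map_preimage[OF \<rho>(1,3), symmetric]
    using inj by (rule inj_image_mem_iff)
  have "?q r \<notin> frontier ?G" if "r \<noteq> \<rho>" for r
  proof (cases "r < \<rho>")
    case True
    then have a: "?a r > 0" using \<rho> by simp
    have "- r / ?a r < ?n - \<rho>"
    proof -
      have "- r < \<rho> - r" using \<rho> by simp
      also have "\<dots> = (?n - \<rho>) * ?a r" using \<rho> by simp
      finally show ?thesis using pos_divide_less_eq[OF a] by blast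
    qed
    also have "\<dots> < rho_G k f \<Gamma>" using \<rho> by simp
    finally have "(?a r / \<rho>) *\<^sub>R (vec 1 - (- r / ?a r) *\<^sub>R axis k 1) \<in> interior ?G"
      by (intro interior_G_set_scale below_rho_G_interior divide_pos_pos a \<rho>(1))
    also have "(b / \<rho>) *\<^sub>R (vec 1 - (- r / b) *\<^sub>R axis k 1)
        = (1 / \<rho>) *\<^sub>R (b *\<^sub>R vec 1 + r *\<^sub>R axis k 1 :: real ^ 'n)" if "0 < b" for b
      using that by (simp add: scaleR_add_right)
    note this[OF a]
    finally show ?thesis by (simp add: frontier_def)
  next
    case False
    then have r: "r > \<rho>" using that by simp
    show ?thesis
    proof
      assume "?q r \<in> frontier ?G"
      then have "(\<rho> / r) *\<^sub>R ?q r \<in> closure ?G"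
        using r \<rho> by (intro closure_G_set_scale[of "?q r"]) (simp_all only: frontier_def Diff_iff divide_pos_pos)
      moreover have "(- ?a r / r) *\<^sub>R vec 1 \<in> (pos_orthant :: (real ^ 'n) set)"
        using r \<rho> by (simp add: pos_orthant_def divide_less_0_iff zero_less_divide_iff)
      ultimately have "(\<rho> / r) *\<^sub>R ?q r + (- ?a r / r) *\<^sub>R vec 1 \<in> interior ?G"
        by (rule closure_G_set_plus_pos)
      also have "(\<rho> / r) *\<^sub>R ?q r + (- ?a r / r) *\<^sub>R vec 1 = axis k 1"
        using r \<rho> by (simp add: scaleR_add_right)
      finally show False using e by (simp add: frontier_def)
    qed
  qed
  moreover have "?q \<rho> \<in> frontier ?G" using e \<rho> by simp
  ultimately show ?thesis
    unfolding rho_G_def tilde by (intro the_equality) auto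
qed

end

section \<open>The family as a shear of the original pair\<close>

definition shear :: "real \<Rightarrow> real ^ 'n \<Rightarrow> real ^ 'n" where
  "shear c x = x + (c * (\<Sum>i\<in>UNIV. x $ i)) *\<^sub>R vec 1"

lemma linear_shear: "linear (shear c)"
  by (intro linearI) (simp_all add: shear_def sum.distrib sum_distrib_left vec_eq_iff algebra_simps)

lemma permute_coords_shear:
  assumes "bij p"
  shows "shear c (permute_coords p x) = permute_coords p (shear c x)"
proof -
  have "(\<Sum>i\<in>UNIV. x $ p i) = (\<Sum>i\<in>UNIV. x $ i)"
    using assms by (intro sum.reindex_bij_betw)
  then show ?thesis by (simp add: shear_def permute_coords_def vec_eq_iff)
qed

text \<open>
  This identity explains the shear: it pulls the linear map in the definition of the family back
  through \<open>P_map \<rho>\<close>. Its proof is the relation \<open>t = 1 + (n - \<rho>) c\<close> between the two parameters.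
\<close>

lemma P_map_shear:
  fixes x :: "real ^ 'n"
  assumes "\<rho> < real CARD('n)"
  shows "P_map \<rho> (shear ((t - 1) / (real CARD('n) - \<rho>)) x)
    = (t * (\<Sum>i\<in>UNIV. x $ i)) *\<^sub>R vec 1 - \<rho> *\<^sub>R x"
proof -
  let ?\<sigma> = "\<Sum>i\<in>UNIV. x $ i" and ?n = "real CARD('n)"
  define c where "c = (t - 1) / (?n - \<rho>)"
  have t: "t = 1 + (?n - \<rho>) * c" using assms by (simp add: c_def)
  have "P_map \<rho> (shear c x) = (t * ?\<sigma>) *\<^sub>R vec 1 - \<rho> *\<^sub>R x"
    unfolding t by (simp add: P_map_def shear_def sum.distrib vec_eq_iff algebra_simps)
  then show ?thesis by (simp add: c_def)
qed

context increasing_concave_pair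
begin

lemma shear_summand_pos:
  assumes "x \<in> \<Gamma>" "0 < c"
  shows "(c * (\<Sum>i\<in>UNIV. x $ i)) *\<^sub>R vec 1 \<in> pos_orthant"
  using symmetric_pair_sum_pos[OF pair assms(1)] assms(2) by (simp add: pos_orthant_def)

lemma shear_in_\<Gamma>: "x \<in> \<Gamma> \<Longrightarrow> 0 < c \<Longrightarrow> shear c x \<in> \<Gamma>"
  using add_\<Gamma>[of x] subsetD[OF pos_\<Gamma> shear_summand_pos[of x c]] by (simp add: shear_def)

lemma shear_in_G_set: "x \<in> G_set f \<Gamma> \<Longrightarrow> 0 < c \<Longrightarrow> shear c x \<in> G_set f \<Gamma>"
  unfolding shear_def by (intro G_set_up shear_summand_pos) (auto simp: G_set_def)

lemma le_shear:
  assumes "x \<in> \<Gamma>" "0 \<le> c"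
  shows "f x \<le> f (shear c x)"
proof (cases "c = 0")
  case False
  then show ?thesis
    unfolding shear_def using assms by (intro mono_f shear_summand_pos) auto
qed (simp add: shear_def)

text \<open>
  The values of the sheared function along the ray through \<open>x\<close> are those of \<open>f\<close> along the ray
  through \<open>shear c x\<close>, so the two limits are literally the same.
\<close>

lemma G_set_shear: "G_set (\<lambda>x. f (shear c x)) (shear c -` \<Gamma>) = shear c -` G_set f \<Gamma>"
  by (auto simp: G_set_def linear_scale[OF linear_shear])

lemma open_vimage_shear: "open S \<Longrightarrow> open (shear c -` S)"
  by (intro open_vimage linear_continuous_on linear_shear[unfolded linear_conv_bounded_linear])

text \<open>
  The shear is linear and commutes with permutations, so every property of the pair pulls back.
  The boundary of the preimage is nonempty because the vertex, a fixed point of the shear, is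
  still missing from it.
\<close>

lemma symmetric_pair_shear:
  assumes "0 < c"
  shows "symmetric_pair (\<lambda>x. f (shear c x)) (shear c -` \<Gamma>)"
proof -
  let ?K = "shear c -` \<Gamma>"
  have pos: "pos_orthant \<subseteq> ?K" using pos_\<Gamma> shear_in_\<Gamma> assms by auto
  have "vec 1 \<in> ?K" by (rule subsetD[OF pos]) (simp add: pos_orthant_def)
  moreover have "0 \<notin> ?K"
    using symmetric_pair_zero_notin[OF pair] by (simp add: linear_0[OF linear_shear])
  ultimately have "frontier ?K \<noteq> {}" by (auto simp: frontier_eq_empty)
  moreover have "smooth_on ?K (\<lambda>x. f (shear c x))"
    using smooth_f C_on_compose_linear[OF linear_shear open_\<Gamma>] by (auto simp: smooth_on_def)
  ultimately show ?thesis
    using pos open_vimage_shear[OF open_\<Gamma>] convex_linear_vimage[OF linear_shear convex_\<Gamma>]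
    by (auto simp: symmetric_pair_def linear_scale[OF linear_shear] permute_coords_shear
        scale_\<Gamma> permute_\<Gamma> permute_f)
qed

text \<open>
  The shear moves \<open>e\<^sub>k\<close> into the open positive orthant, whose preimage is therefore a neighbourhood
  of \<open>e\<^sub>k\<close> inside the preimage of \<open>G\<close>.
\<close>

lemma type2_pair_shear:
  assumes "0 < c"
  shows "type2_pair k (\<lambda>x. f (shear c x)) (shear c -` \<Gamma>)"
proof -
  have "shear c (axis k 1) \<in> pos_orthant"
  proof -
    have "0 \<le> axis k (1::real) $ i" for i by (simp add: axis_def)
    then show ?thesis
      using assms by (auto simp: shear_def pos_orthant_def sum_axis intro: add_nonneg_pos)
  qed
  moreover have "shear c -` pos_orthant \<subseteq> interior (shear c -` G_set f \<Gamma>)"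
    using pos_orthant_subset_G_set
    by (intro interior_maximal open_vimage_shear open_pos_orthant vimage_mono)
  ultimately show ?thesis
    using symmetric_pair_shear[OF assms] by (auto simp: type2_pair_def G_set_shear)
qed

lemma family_eq_shear:
  fixes k :: 'n
  assumes "axis k 1 \<in> frontier (G_set f \<Gamma>)"
    and \<rho>: "0 < \<rho>" "real CARD('n) - rho_G k f \<Gamma> < \<rho>" "\<rho> < real CARD('n)"
  defines "c t \<equiv> (t - 1) / (real CARD('n) - \<rho>)"
  shows "family_fun k \<rho> f \<Gamma> t = (\<lambda>x. f (shear (c t) x))"
    and "family_cone k \<rho> f \<Gamma> t = shear (c t) -` \<Gamma>"
proof -
  have map: "family_map k \<rho> f \<Gamma> t x = P_map \<rho> (shear (c t) x)" for x
    using \<rho>(3) by (simp add: family_map_def rho_G_tilde[OF assms(1) \<rho>] P_map_shear c_def)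
  note inj = inj_P_map[OF \<rho>(1,3)]
  show "family_fun k \<rho> f \<Gamma> t = (\<lambda>x. f (shear (c t) x))"
    by (rule ext) (simp add: family_fun_def map tilde_fun_def inv_f_f[OF inj])
  show "family_cone k \<rho> f \<Gamma> t = shear (c t) -` \<Gamma>"
    by (auto simp: family_cone_def map tilde_cone_def inj_image_mem_iff[OF inj])
qed

end

theorem theorem2p5:
  fixes f :: "real ^ 'n \<Rightarrow> real" and \<Gamma> :: "(real ^ 'n) set" and \<rho> :: real and k :: 'n
  assumes "2 \<le> CARD('n)"
    and "type1_pair k f \<Gamma>"
    and "concave_on \<Gamma> f"
    and "\<forall>x\<in>\<Gamma>. \<forall>i. partial_deriv i f x > 0"
    and "axis k 1 \<in> frontier (G_set f \<Gamma>)"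
    and "0 < \<rho>"
    and "real CARD('n) - rho_G k f \<Gamma> < \<rho>"
    and "\<rho> < real CARD('n)"
  shows "(\<forall>t>1. \<Gamma> \<subseteq> family_cone k \<rho> f \<Gamma> t \<and>
            G_set f \<Gamma> \<subseteq> G_set (family_fun k \<rho> f \<Gamma> t) (family_cone k \<rho> f \<Gamma> t)) \<and>
         (family_cone k \<rho> f \<Gamma> 1 = \<Gamma> \<and> (\<forall>x\<in>\<Gamma>. family_fun k \<rho> f \<Gamma> 1 x = f x)) \<and>
         (\<forall>t>1. type2_pair k (family_fun k \<rho> f \<Gamma> t) (family_cone k \<rho> f \<Gamma> t)) \<and>
         (\<forall>t\<ge>1. \<forall>x\<in>\<Gamma>. family_fun k \<rho> f \<Gamma> t x \<ge> f x)"
proof -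
  interpret increasing_concave_pair f \<Gamma>
    using assms(2-4) by unfold_locales (auto simp: type1_pair_def)
  define c where "c t = (t - 1) / (real CARD('n) - \<rho>)" for t
  note family = family_eq_shear[OF assms(5-8), folded c_def]
  have c: "0 < c t" if "1 < t" for t using that assms(8) by (simp add: c_def)
  have c1: "c 1 = 0" by (simp add: c_def)
  have c0: "0 \<le> c t" if "1 \<le> t" for t using that assms(8) by (simp add: c_def)
  have id: "shear 0 = (\<lambda>x :: real ^ 'n. x)" by (auto simp: shear_def)
  show ?thesis
    unfolding family
  proof (intro conjI allI impI ballI)
    fix t :: real assume "1 < t"
    then show "\<Gamma> \<subseteq> shear (c t) -` \<Gamma>" using shear_in_\<Gamma> c by auto
    show "G_set f \<Gamma> \<subseteq> G_set (\<lambda>x. f (shear (c t) x)) (shear (c t) -` \<Gamma>)"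
      unfolding G_set_shear using shear_in_G_set c[OF \<open>1 < t\<close>] by auto
    show "type2_pair k (\<lambda>x. f (shear (c t) x)) (shear (c t) -` \<Gamma>)"
      using type2_pair_shear c[OF \<open>1 < t\<close>] .
  next
    fix t :: real and x assume "1 \<le> t" "x \<in> \<Gamma>"
    then show "f x \<le> f (shear (c t) x)" using le_shear c0 by simp
  qed (simp_all add: c1 id)
qed

end
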